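(* Consider data generating processes satisfying randomization (as defined in the context; the surrogate is not assumed to be strong), and suppose the observed quantities $\{P(S,Y\mid T=0),\,P(S\mid T=1),\,\gamma_0,\,\gamma_1\}$ are known (that is, they are given values which are produced by at least one such process), where $\gamma_t=P(Y_{t1}=1)-P(Y_{t0}=1)$ for $t=0,1$. Then the sharp bounds for $\mathrm{ACE}(T\rightarrow Y)$ are $[L',U']$, where $$L'=\max\{-P(Y=1\mid T=0),\; -\gamma_1-P(Y=1\mid T=0)-P(S=1\mid T=1),\; \gamma_1-P(Y=1\mid T=0)-P(S=0\mid T=1)\}$$ and $$U'=\min\{P(Y=0\mid T=0),\; -\gamma_1+P(Y=0\mid T=0)+P(S=1\mid T=1),\; \gamma_1+P(Y=0\mid T=0)+P(S=0\mid T=1)\}.$$ That is, every such process with these observed quantities satisfies $L'\le \mathrm{ACE}(T\rightarrow Y)\le U'$, and each of the values $L'$ and $U'$ is attained by some such process with the same observed quantities.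
   Context: $T$ (treatment), $S$ (surrogate), $Y$ (primary outcome) are binary, with values in $\{0,1\}$; $U$ is an unobserved confounder of $S$ and $Y$ taking values in an arbitrary space, with no restriction on its distribution or on how it affects $S$ and $Y$. $S_t$ is the potential value of $S$ when $T$ is set to $t$; $Y_{ts}$ is the potential value of $Y$ when $T$ is set to $t$ and $S$ to $s$; $Y_{T=t}=Y_{t,S_t}$ is the potential value of $Y$ when only $T$ is set to $t$. Observed values are $S=S_T$ and $Y=Y_{T,S_T}$. It is assumed that $0<P(T=1)<1$. Randomization: $T$ is independent of $(Y_{00},Y_{01},Y_{10},Y_{11},S_0,S_1,U)$. Non-strong surrogate setting: the causal diagram has edges $T\to S$, $S\to Y$, $U\to S$, $U\to Y$ and also $T\to Y$, so $Y_{ts}$ may depend on both $t$ and $s$. Since $U$ is unrestricted, the joint distribution of the binary vector $(Y_{00},Y_{01},Y_{10},Y_{11},S_0,S_1)$ can be an arbitrary probability distribution on $\{0,1\}^6$, and $T$ is independent of it. Average causal effect: $\mathrm{ACE}(T\rightarrow Y)=P(Y_{T=1}=1)-P(Y_{T=0}=1)$. *)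

theory Defs
  imports "HOL-Probability.Probability"
begin

(* Binary variables are bool-valued, with True for 1 and False for 0.
   surr t is the potential value S_t and prim t s is the potential value Y_{ts};
   no relation between prim True s and prim False s is imposed, so the surrogate
   need not be strong. *)
record ('w, 'u) process =
  law :: "'w measure"
  treat :: "'w \<Rightarrow> bool"
  surr :: "bool \<Rightarrow> 'w \<Rightarrow> bool"
  prim :: "bool \<Rightarrow> bool \<Rightarrow> 'w \<Rightarrow> bool"
  conf_space :: "'u measure"
  conf :: "'w \<Rightarrow> 'u"

definition prim_do :: "('w, 'u) process \<Rightarrow> bool \<Rightarrow> 'w \<Rightarrow> bool" where
  "prim_do D t \<omega> = prim D t (surr D t \<omega>) \<omega>"

definition obs_surr :: "('w, 'u) process \<Rightarrow> 'w \<Rightarrow> bool" where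
  "obs_surr D \<omega> = surr D (treat D \<omega>) \<omega>"

definition obs_prim :: "('w, 'u) process \<Rightarrow> 'w \<Rightarrow> bool" where
  "obs_prim D \<omega> = prim D (treat D \<omega>) (obs_surr D \<omega>) \<omega>"

abbreviation bit :: "bool measure" where
  "bit \<equiv> count_space UNIV"

type_synonym bits6 = "bool \<times> bool \<times> bool \<times> bool \<times> bool \<times> bool"

definition latent ::
    "('w, 'u) process \<Rightarrow> 'w \<Rightarrow> bool \<times> bool \<times> bool \<times> bool \<times> bool \<times> bool \<times> 'u" where
  "latent D \<omega> = (prim D False False \<omega>, prim D False True \<omega>,
                 prim D True False \<omega>, prim D True True \<omega>,
                 surr D False \<omega>, surr D True \<omega>, conf D \<omega>)"

definition latent_space ::
    "('w, 'u) process \<Rightarrow> (bool \<times> bool \<times> bool \<times> bool \<times> bool \<times> bool \<times> 'u) measure" where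
  "latent_space D = bit \<Otimes>\<^sub>M bit \<Otimes>\<^sub>M bit \<Otimes>\<^sub>M bit \<Otimes>\<^sub>M bit \<Otimes>\<^sub>M bit \<Otimes>\<^sub>M conf_space D"

(* Independence of treat and latent is written with indep_set on the generated
   sigma-algebras because indep_var requires both variables to have the same
   value type. *)
definition randomized_process :: "('w, 'u) process \<Rightarrow> bool" where
  "randomized_process D \<longleftrightarrow>
     prob_space (law D) \<and>
     treat D \<in> law D \<rightarrow>\<^sub>M bit \<and>
     latent D \<in> law D \<rightarrow>\<^sub>M latent_space D \<and>
     0 < \<P>(\<omega> in law D. treat D \<omega>) \<and> \<P>(\<omega> in law D. treat D \<omega>) < 1 \<and>
     prob_space.indep_set (law D)
       {treat D -` A \<inter> space (law D) | A. A \<in> sets bit}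
       {latent D -` B \<inter> space (law D) | B. B \<in> sets (latent_space D)}"

definition gam :: "('w, 'u) process \<Rightarrow> bool \<Rightarrow> real" where
  "gam D t = \<P>(\<omega> in law D. prim D t True \<omega>) - \<P>(\<omega> in law D. prim D t False \<omega>)"

definition ACE :: "('w, 'u) process \<Rightarrow> real" where
  "ACE D = \<P>(\<omega> in law D. prim_do D True \<omega>) - \<P>(\<omega> in law D. prim_do D False \<omega>)"

definition prob_SY_given_T :: "('w, 'u) process \<Rightarrow> bool \<Rightarrow> bool \<Rightarrow> bool \<Rightarrow> real" where
  "prob_SY_given_T D s y t =
     \<P>(\<omega> in law D. obs_surr D \<omega> = s \<and> obs_prim D \<omega> = y \<bar> treat D \<omega> = t)"

definition prob_S_given_T :: "('w, 'u) process \<Rightarrow> bool \<Rightarrow> bool \<Rightarrow> real" where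
  "prob_S_given_T D s t = \<P>(\<omega> in law D. obs_surr D \<omega> = s \<bar> treat D \<omega> = t)"

definition prob_Y_given_T :: "('w, 'u) process \<Rightarrow> bool \<Rightarrow> bool \<Rightarrow> real" where
  "prob_Y_given_T D y t = \<P>(\<omega> in law D. obs_prim D \<omega> = y \<bar> treat D \<omega> = t)"

definition same_observed :: "('w, 'u) process \<Rightarrow> ('v, 'x) process \<Rightarrow> bool" where
  "same_observed D E \<longleftrightarrow>
     (\<forall>s y. prob_SY_given_T D s y False = prob_SY_given_T E s y False) \<and>
     (\<forall>s. prob_S_given_T D s True = prob_S_given_T E s True) \<and>
     gam D False = gam E False \<and> gam D True = gam E True"

definition lower_bound :: "('w, 'u) process \<Rightarrow> real" where
  "lower_bound D = Max
     {- prob_Y_given_T D True False,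
      - gam D True - prob_Y_given_T D True False - prob_S_given_T D True True,
      gam D True - prob_Y_given_T D True False - prob_S_given_T D False True}"

definition upper_bound :: "('w, 'u) process \<Rightarrow> real" where
  "upper_bound D = Min
     {prob_Y_given_T D False False,
      - gam D True + prob_Y_given_T D False False + prob_S_given_T D True True,
      gam D True + prob_Y_given_T D False False + prob_S_given_T D False True}"

end

theory Submission
  imports Defs
begin

text \<open>
  By randomization, conditioning on treatment \<open>t\<close> reveals the law of the triple
  \<open>(Y_t0, Y_t1, S_t)\<close>. Every observed quantity and the causal effect depend only on the two laws
  obtained for \<open>t = 0\<close> and \<open>t = 1\<close>, and these can be prescribed independently of each other. The
  first law already determines \<open>P(Y_{T=0} = 1) = P(Y = 1 | T = 0)\<close>, so the problem becomes that of
  finding the extreme values of \<open>P(Y_{1,S_1} = 1)\<close> given \<open>P(S_1 = 1)\<close> and \<open>\<gamma>\<^sub>1\<close>. Bonferroni's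
  inequality gives the bounds. They are attained when one of \<open>Y_10\<close>, \<open>Y_11\<close> is constant and the
  other is coupled with \<open>S_1\<close> so that the overlap is as small as possible. Complementing \<open>Y\<close>
  exchanges the lower and the upper bound.
\<close>

type_synonym arm = "bool \<times> bool \<times> bool"

definition arm :: "('w, 'u) process \<Rightarrow> bool \<Rightarrow> 'w \<Rightarrow> arm" where
  "arm D t \<omega> = (prim D t False \<omega>, prim D t True \<omega>, surr D t \<omega>)"

definition arm_surr :: "arm \<Rightarrow> bool" where
  "arm_surr a = snd (snd a)"

definition arm_prim :: "bool \<Rightarrow> arm \<Rightarrow> bool" where
  "arm_prim s a = (if s then fst (snd a) else fst a)"

definition arm_resp :: "arm \<Rightarrow> bool" where
  "arm_resp a = arm_prim (arm_surr a) a"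

lemmas arm_defs = arm_surr_def arm_prim_def arm_resp_def

text \<open>Encoded as a \<open>pmf\<close> so that laws coming from a process and laws built by
  hand share one type. For a randomized process, \<open>measure_pmf_arm_law\<close> shows that
  \<open>Abs_pmf\<close> loses nothing.\<close>

definition arm_law :: "('w, 'u) process \<Rightarrow> bool \<Rightarrow> arm pmf" where
  "arm_law D t = Abs_pmf (distr (law D) (count_space UNIV) (arm D t))"

subsection \<open>Reduction to the laws of the two arms\<close>

text \<open>Measurability and independence of treatment are assumed for \<open>latent D\<close> as a
  whole; factoring \<open>arm D t\<close> through it lets the arm inherit both.\<close>

definition latent_arm :: "bool \<Rightarrow> bool \<times> bool \<times> bool \<times> bool \<times> bool \<times> bool \<times> 'u \<Rightarrow> arm" where
  "latent_arm t = (\<lambda>(y00, y01, y10, y11, s0, s1, u).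
     if t then (y10, y11, s1) else (y00, y01, s0))"

lemma latent_arm_latent: "latent_arm t (latent D \<omega>) = arm D t \<omega>"
  by (cases t) (simp_all add: latent_arm_def latent_def arm_def)

lemma measurable_latent_arm: "latent_arm t \<in> latent_space D \<rightarrow>\<^sub>M count_space UNIV"
proof -
  have "latent_arm t -` {a} \<inter> space (latent_space D) \<in> sets (latent_space D)" for a
  proof -
    obtain x y z where a: "a = (x, y, z)" by (metis prod_cases3)
    have "latent_arm t -` {a} \<inter> space (latent_space D) =
      {w \<in> space (latent_space D).
        if t then fst (snd (snd w)) = x \<and> fst (snd (snd (snd w))) = y
                  \<and> fst (snd (snd (snd (snd (snd w))))) = z
        else fst w = x \<and> fst (snd w) = y \<and> fst (snd (snd (snd (snd w)))) = z}"
      by (auto simp: a latent_arm_def split: prod.splits if_splits)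
    also have "\<dots> \<in> sets (latent_space D)"
      unfolding latent_space_def by (cases t) simp_all
    finally show ?thesis .
  qed
  then show ?thesis
    by (simp add: measurable_count_space_eq2_countable)
qed

lemma measurable_arm:
  assumes "randomized_process D"
  shows "arm D t \<in> law D \<rightarrow>\<^sub>M count_space UNIV"
proof -
  have "latent D \<in> law D \<rightarrow>\<^sub>M latent_space D"
    using assms by (simp add: randomized_process_def)
  from measurable_compose[OF this measurable_latent_arm[of t]]
  show ?thesis by (simp add: latent_arm_latent)
qed

text \<open>On a finite type the whole space is a countable set of full measure, so almost every
  point has positive mass, as the subtype \<open>pmf\<close> demands.\<close>

lemma Abs_pmf_inverse_finite:
  fixes M :: "'a :: finite measure"
  assumes "prob_space M" "sets M = UNIV"
  shows "measure_pmf (Abs_pmf M) = M"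
proof (rule Abs_pmf_inverse)
  interpret prob_space M by fact
  have "\<exists>S. countable S \<and> (AE x in M. x \<in> S)"
    by (rule exI[of _ UNIV]) (simp add: countable_finite)
  then have "AE x in M. measure M {x} \<noteq> 0"
    using AE_support_countable[OF assms(2)] by blast
  then show "M \<in> {M. prob_space M \<and> sets M = UNIV \<and> (AE x in M. measure M {x} \<noteq> 0)}"
    using assms by simp
qed

lemma measure_pmf_arm_law:
  assumes "randomized_process D"
  shows "measure_pmf (arm_law D t) = distr (law D) (count_space UNIV) (arm D t)"
proof -
  interpret prob_space "law D" using assms by (simp add: randomized_process_def)
  show ?thesis
    unfolding arm_law_def
    by (intro Abs_pmf_inverse_finite prob_space_distr measurable_arm assms) simp
qed

lemma prob_arm:
  assumes "randomized_process D"
  shows "\<P>(\<omega> in law D. Q (arm D t \<omega>)) = measure (arm_law D t) {a. Q a}"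
  unfolding measure_pmf_arm_law[OF assms]
  by (subst measure_distr[OF measurable_arm[OF assms]])
     (auto intro: arg_cong[of _ _ "measure (law D)"])

text \<open>Makes conditioning on either treatment value a genuine quotient, with no division by
  zero.\<close>

lemma prob_treat_pos:
  assumes "randomized_process D"
  shows "0 < \<P>(\<omega> in law D. treat D \<omega> = t)"
proof -
  interpret prob_space "law D" using assms by (simp add: randomized_process_def)
  have m[measurable]: "treat D \<in> law D \<rightarrow>\<^sub>M bit"
    using assms by (simp add: randomized_process_def)
  have "\<P>(\<omega> in law D. \<not> treat D \<omega>) = 1 - \<P>(\<omega> in law D. treat D \<omega>)"
    by (rule prob_neg) measurable
  then show ?thesis
    using assms by (cases t) (simp_all add: randomized_process_def)
qed

text \<open>The event \<open>Q (arm D t \<omega>)\<close> is the preimage under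
  \<open>latent D\<close> of a measurable set, hence independent of treatment; the positive
  probability of \<open>treat D \<omega> = t\<close> then cancels.\<close>

lemma cond_prob_arm:
  assumes "randomized_process D"
  shows "\<P>(\<omega> in law D. Q (arm D t \<omega>) \<bar> treat D \<omega> = t) = measure (arm_law D t) {a. Q a}"
proof -
  interpret prob_space "law D" using assms by (simp add: randomized_process_def)
  let ?A = "treat D -` {t} \<inter> space (law D)"
  let ?X = "latent_arm t -` {a. Q a} \<inter> space (latent_space D)"
  let ?B = "latent D -` ?X \<inter> space (law D)"
  have lat: "latent D \<in> law D \<rightarrow>\<^sub>M latent_space D"
    using assms by (simp add: randomized_process_def)
  have X: "?X \<in> sets (latent_space D)"
    by (rule measurable_sets[OF measurable_latent_arm]) simp
  have B: "?B = {\<omega> \<in> space (law D). Q (arm D t \<omega>)}"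
    using measurable_space[OF lat] by (auto simp: latent_arm_latent)
  have ind: "prob (?A \<inter> ?B) = prob ?A * prob ?B"
  proof (rule indep_setD)
    show "indep_set {treat D -` A \<inter> space (law D) | A. A \<in> sets bit}
       {latent D -` B \<inter> space (law D) | B. B \<in> sets (latent_space D)}"
      using assms by (simp add: randomized_process_def)
    show "?A \<in> {treat D -` A \<inter> space (law D) | A. A \<in> sets bit}"
      by auto
    show "?B \<in> {latent D -` B \<inter> space (law D) | B. B \<in> sets (latent_space D)}"
      using X by blast
  qed
  have A: "?A = {\<omega> \<in> space (law D). treat D \<omega> = t}" by auto
  have AB: "?A \<inter> ?B = {\<omega> \<in> space (law D). Q (arm D t \<omega>) \<and> treat D \<omega> = t}"
    unfolding A B by auto
  show ?thesis
    using ind prob_treat_pos[OF assms, of t] prob_arm[OF assms, of Q t]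
    unfolding cond_prob_def AB[symmetric] A[symmetric] B[symmetric] by simp
qed

text \<open>Observed variables agree with functions of the arm only where
  \<open>treat D \<omega> = t\<close>, so they can be exchanged only under this
  conditioning.\<close>

lemma cond_prob_treat_cong:
  assumes "\<And>\<omega>. treat D \<omega> = t \<Longrightarrow> P \<omega> \<longleftrightarrow> Q \<omega>"
  shows "\<P>(\<omega> in law D. P \<omega> \<bar> treat D \<omega> = t) = \<P>(\<omega> in law D. Q \<omega> \<bar> treat D \<omega> = t)"
proof -
  have "{\<omega> \<in> space (law D). P \<omega> \<and> treat D \<omega> = t} = {\<omega> \<in> space (law D). Q \<omega> \<and> treat D \<omega> = t}"
    using assms by auto
  then show ?thesis by (simp add: cond_prob_def)
qed

lemma obs_arm:
  assumes "treat D \<omega> = t"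
  shows "obs_surr D \<omega> = arm_surr (arm D t \<omega>)" "obs_prim D \<omega> = arm_resp (arm D t \<omega>)"
  using assms by (simp_all add: obs_surr_def obs_prim_def arm_def arm_defs)

section \<open>Observed quantities, causal effect and bounds in terms of the arm laws\<close>

lemma
  assumes "randomized_process D"
  shows prob_SY_arm: "prob_SY_given_T D s y t =
      measure (arm_law D t) {a. arm_surr a = s \<and> arm_resp a = y}"
    and prob_S_arm: "prob_S_given_T D s t = measure (arm_law D t) {a. arm_surr a = s}"
    and prob_Y_arm: "prob_Y_given_T D y t = measure (arm_law D t) {a. arm_resp a = y}"
  unfolding prob_SY_given_T_def prob_S_given_T_def prob_Y_given_T_def
  unfolding cond_prob_arm[OF assms, symmetric]
  by (rule cond_prob_treat_cong; simp add: obs_arm)+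

definition contrast :: "arm pmf \<Rightarrow> real" where
  "contrast p = measure p {a. arm_prim True a} - measure p {a. arm_prim False a}"

lemma gam_arm:
  assumes "randomized_process D"
  shows "gam D t = contrast (arm_law D t)"
  unfolding gam_def contrast_def prob_arm[OF assms, symmetric]
  by (simp add: arm_def arm_prim_def)

lemma ACE_arm:
  assumes "randomized_process D"
  shows "ACE D = measure (arm_law D True) {a. arm_resp a} - measure (arm_law D False) {a. arm_resp a}"
proof -
  have "prim_do D t \<omega> = arm_resp (arm D t \<omega>)" for t \<omega>
    by (simp add: prim_do_def arm_def arm_defs)
  then show ?thesis by (simp add: ACE_def prob_arm[OF assms])
qed

lemma measure_pmf_Collect_not:
  "measure (measure_pmf p) {a. \<not> Q a} = 1 - measure p {a. Q a}"
  using measure_pmf.prob_compl[of "{a. Q a}" p] by (simp add: Collect_neg_eq Compl_eq_Diff_UNIV)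

text \<open>All three entries subtract P(Y = 1 | T = 0), which is also the term subtracted in
  \<open>ACE_arm\<close>. Pulling it out leaves a bound that concerns arm 1 alone.\<close>

lemma lower_bound_arm:
  assumes "randomized_process D"
  shows "lower_bound D =
    Max {0, - contrast (arm_law D True) - measure (arm_law D True) {a. arm_surr a},
         contrast (arm_law D True) - (1 - measure (arm_law D True) {a. arm_surr a})}
    - measure (arm_law D False) {a. arm_resp a}"
  by (simp add: lower_bound_def prob_S_arm[OF assms] prob_Y_arm[OF assms] gam_arm[OF assms]
        measure_pmf_Collect_not)

lemma upper_bound_arm:
  assumes "randomized_process D"
  shows "upper_bound D =
    Min {1, 1 - contrast (arm_law D True) + measure (arm_law D True) {a. arm_surr a},
         1 + contrast (arm_law D True) + (1 - measure (arm_law D True) {a. arm_surr a})}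
    - measure (arm_law D False) {a. arm_resp a}"
  by (simp add: upper_bound_def prob_S_arm[OF assms] prob_Y_arm[OF assms] gam_arm[OF assms]
        measure_pmf_Collect_not)

text \<open>The bounds use the marginal of Y given T = 0, while \<open>same_observed\<close> fixes
  the joint table of S and Y; summing over S connects the two.\<close>

lemma prob_Y_eq_sum_prob_SY:
  assumes "randomized_process D"
  shows "prob_Y_given_T D y t = prob_SY_given_T D False y t + prob_SY_given_T D True y t"
  unfolding prob_Y_arm[OF assms] prob_SY_arm[OF assms]
  by (subst measure_pmf.finite_measure_Union[symmetric])
     (auto intro: arg_cong[of _ _ "measure (arm_law D t)"])

lemma same_observed_bounds:
  assumes "randomized_process D" "randomized_process E" "same_observed D E"
  shows "lower_bound D = lower_bound E" "upper_bound D = upper_bound E"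
  using assms
  by (simp_all add: lower_bound_def upper_bound_def same_observed_def prob_Y_eq_sum_prob_SY)

section \<open>Construction of a process with prescribed arm laws\<close>

lemma randomized_process_with_arm_laws:
  fixes p q :: "arm pmf"
  obtains D :: "(bool \<times> bits6, bits6) process"
  where "randomized_process D" "arm_law D False = p" "arm_law D True = q"
proof -
  define join :: "arm \<times> arm \<Rightarrow> bits6" where
    "join = (\<lambda>((y00, y01, s0), (y10, y11, s1)). (y00, y01, y10, y11, s0, s1))"
  \<comment> \<open>The arms are coupled independently; any coupling with marginals \<open>p\<close>
    and \<open>q\<close> would serve, since only the two marginals are prescribed. Treatment is a
    fair coin independent of both.\<close>
  define L where "L = map_pmf join (pair_pmf p q)"
  define M where "M = pair_pmf (bernoulli_pmf (1/2)) L"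
  \<comment> \<open>The confounder is the full vector of potential values, so each of them is a
    function of \<open>conf\<close>.\<close>
  define D :: "(bool \<times> bits6, bits6) process" where
    "D = \<lparr>law = measure_pmf M, treat = fst,
      surr = (\<lambda>t (_, _, _, _, _, s0, s1). if t then s1 else s0),
      prim = (\<lambda>t s (_, y00, y01, y10, y11, _, _).
        if t then (if s then y11 else y10) else (if s then y01 else y00)),
      conf_space = count_space UNIV, conf = snd\<rparr>"
  have sp: "space (latent_space D) = UNIV"
    by (simp add: latent_space_def D_def space_pair_measure)
  have mfst: "measure_pmf.prob M (fst -` A) = measure (bernoulli_pmf (1/2)) A" for A
    unfolding M_def measure_map_pmf[symmetric] map_fst_pair_pmf ..
  have msnd: "measure_pmf.prob M (snd -` B) = measure L B" for B
    unfolding M_def measure_map_pmf[symmetric] map_snd_pair_pmf ..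
  have ind: "measure M (fst -` A \<inter> snd -` B) = measure M (fst -` A) * measure M (snd -` B)" for A B
  proof -
    have "fst -` A \<inter> snd -` B = A \<times> B"
      by (rule set_eqI) (simp only: Int_iff vimage_eq mem_Times_iff)
    then show ?thesis
      using measure_pmf_prob_product[of A B "bernoulli_pmf (1/2)" L]
      unfolding M_def[symmetric] mfst msnd by simp
  qed
  define f :: "bits6 \<Rightarrow> bool \<times> bool \<times> bool \<times> bool \<times> bool \<times> bool \<times> bits6" where
    "f = (\<lambda>(y00, y01, y10, y11, s0, s1).
      (y00, y01, y10, y11, s0, s1, (y00, y01, y10, y11, s0, s1)))"
  have f: "latent D = f \<circ> snd"
    by (auto simp: latent_def D_def f_def fun_eq_iff)
  have rp: "randomized_process D"
    unfolding randomized_process_def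
  proof (intro conjI)
    show "prob_space (law D)" by (simp add: D_def measure_pmf.prob_space_axioms)
    show "treat D \<in> law D \<rightarrow>\<^sub>M bit" "latent D \<in> law D \<rightarrow>\<^sub>M latent_space D"
      by (simp_all add: D_def sp[unfolded D_def])
    have "\<P>(\<omega> in law D. treat D \<omega>) = 1/2"
      using mfst[of "{True}"] by (simp add: D_def vimage_def measure_pmf_single)
    then show "0 < \<P>(\<omega> in law D. treat D \<omega>)" "\<P>(\<omega> in law D. treat D \<omega>) < 1" by simp_all
    show "prob_space.indep_set (law D)
       {treat D -` A \<inter> space (law D) | A. A \<in> sets bit}
       {latent D -` B \<inter> space (law D) | B. B \<in> sets (latent_space D)}"
    proof (rule prob_space.indep_setI)
      show "prob_space (law D)" by (simp add: D_def measure_pmf.prob_space_axioms)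
    next
      fix u v
      assume "u \<in> {treat D -` A \<inter> space (law D) | A. A \<in> sets bit}"
        "v \<in> {latent D -` B \<inter> space (law D) | B. B \<in> sets (latent_space D)}"
      then obtain A B where "u = fst -` A" "v = latent D -` B"
        by (auto simp: D_def)
      then have "u = fst -` A" "v = snd -` (f -` B)"
        by (auto simp: f)
      then show "measure (law D) (u \<inter> v) = measure (law D) u * measure (law D) v"
        using ind by (simp add: D_def)
    qed (auto simp: D_def)
  qed
  have L: "map_pmf snd M = L"
    unfolding M_def by (rule map_snd_pair_pmf)
  have arms: "arm_law D t = map_pmf (arm D t) M" for t
    by (rule measure_pmf_inject[THEN iffD1])
       (simp add: measure_pmf_arm_law[OF rp] map_pmf_rep_eq, simp add: D_def)
  have "map_pmf (arm D False) M = map_pmf (\<lambda>(a, b, c, d, e, f). (a, b, e)) (map_pmf snd M)"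
    unfolding map_pmf_comp by (rule map_pmf_cong) (auto simp: arm_def D_def)
  also have "\<dots> = map_pmf fst (pair_pmf p q)"
    unfolding L L_def map_pmf_comp
    by (rule map_pmf_cong) (auto simp: join_def)
  finally have p: "arm_law D False = p" by (simp add: arms map_fst_pair_pmf)
  have "map_pmf (arm D True) M = map_pmf (\<lambda>(a, b, c, d, e, f). (c, d, f)) (map_pmf snd M)"
    unfolding map_pmf_comp by (rule map_pmf_cong) (auto simp: arm_def D_def)
  also have "\<dots> = map_pmf snd (pair_pmf p q)"
    unfolding L L_def map_pmf_comp
    by (rule map_pmf_cong) (auto simp: join_def)
  finally have q: "arm_law D True = q" by (simp add: arms map_snd_pair_pmf)
  show thesis using that rp p q by blast
qed

subsection \<open>Extreme values of the response probability in one arm\<close>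

definition flip_prim :: "arm \<Rightarrow> arm" where
  "flip_prim = (\<lambda>(y0, y1, s). (\<not> y0, \<not> y1, s))"

lemma flip_prim_simps:
  "arm_surr (flip_prim a) = arm_surr a"
  "arm_prim s (flip_prim a) \<longleftrightarrow> \<not> arm_prim s a"
  "arm_resp (flip_prim a) \<longleftrightarrow> \<not> arm_resp a"
  by (cases a; simp add: flip_prim_def arm_defs)+

lemma
  fixes p :: "arm pmf"
  shows surr_map_flip: "measure (map_pmf flip_prim p) {a. arm_surr a} = measure p {a. arm_surr a}"
    and resp_map_flip:
      "measure (map_pmf flip_prim p) {a. arm_resp a} = 1 - measure p {a. arm_resp a}"
    and contrast_map_flip: "contrast (map_pmf flip_prim p) = - contrast p"
  by (simp_all add: contrast_def vimage_def flip_prim_simps measure_pmf_Collect_not)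

text \<open>Supplies the condition under which the weights of the extremal laws below are
  nonnegative.\<close>

lemma abs_contrast_le_1: "\<bar>contrast p\<bar> \<le> 1"
proof -
  have "0 \<le> measure p A \<and> measure p A \<le> 1" for A by simp
  then show ?thesis unfolding contrast_def by (smt (verit))
qed

text \<open>Where the potential value for surrogate level \<open>s\<close> is true, either the
  response is true or the surrogate differs from \<open>s\<close>. The union bound for each
  \<open>s\<close> gives the two nontrivial entries.\<close>

lemma response_lower:
  fixes p :: "arm pmf"
  shows "Max {0, - contrast p - measure p {a. arm_surr a},
        contrast p - (1 - measure p {a. arm_surr a})} \<le> measure p {a. arm_resp a}"
proof -
  have cover: "measure p {a. arm_prim s a} \<le>
      measure p {a. arm_resp a} + measure p {a. arm_surr a \<noteq> s}" for s
  proof -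
    have "measure p {a. arm_prim s a} \<le> measure p ({a. arm_resp a} \<union> {a. arm_surr a \<noteq> s})"
      by (rule measure_pmf.finite_measure_mono) (auto simp: arm_defs split: if_splits)
    also have "\<dots> \<le> measure p {a. arm_resp a} + measure p {a. arm_surr a \<noteq> s}"
      by (rule measure_Un_le) auto
    finally show ?thesis .
  qed
  have "measure p {a. arm_prim True a} \<le> measure p {a. arm_resp a} + (1 - measure p {a. arm_surr a})"
    "measure p {a. arm_prim False a} \<le> measure p {a. arm_resp a} + measure p {a. arm_surr a}"
    using cover[of True] cover[of False] by (simp_all add: measure_pmf_Collect_not)
  \<comment> \<open>Each entry bounds one sign of the contrast \<open>t - f\<close> by discarding
    the nonnegative probability that is subtracted.\<close>
  moreover have "Max {0, - (t - f) - s, (t - f) - (1 - s)} \<le> r"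
    if "t \<le> r + (1 - s)" "f \<le> r + s" "0 \<le> t" "0 \<le> f" "0 \<le> r" for t f r s :: real
    using that by simp
  ultimately show ?thesis
    unfolding contrast_def by (simp only: measure_nonneg)
qed

text \<open>Flipping the potential values negates the contrast and complements the response, so the
  lower bound for the flipped law is the claim.\<close>

lemma response_upper:
  fixes p :: "arm pmf"
  shows "measure p {a. arm_resp a} \<le> Min {1, 1 - contrast p + measure p {a. arm_surr a},
        1 + contrast p + (1 - measure p {a. arm_surr a})}"
  using response_lower[of "map_pmf flip_prim p"]
  unfolding surr_map_flip resp_map_flip contrast_map_flip by simp

lemma response_lower_attained:
  fixes g \<pi> :: real
  assumes "\<bar>g\<bar> \<le> 1" "0 \<le> \<pi>" "\<pi> \<le> 1"
  obtains p :: "arm pmf" where "contrast p = g" "measure p {a. arm_surr a} = \<pi>"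
    "measure p {a. arm_resp a} = Max {0, - g - \<pi>, g - (1 - \<pi>)}"
proof (cases "0 \<le> g")
  case True
  \<comment> \<open>With Y_10 constantly false and Y_11 true with probability \<open>g\<close>, the
    response is true exactly when Y_11 and the surrogate both are. The least overlap of events of
    probabilities \<open>g\<close> and \<open>\<pi>\<close> is \<open>m\<close>; the entry
    \<open>- g - \<pi>\<close> is at most 0 here.\<close>
  define m where "m = max 0 (g - (1 - \<pi>))"
  define xs where "xs = [((False, True, True), m), ((False, True, False), g - m),
    ((False, False, True), \<pi> - m), ((False, False, False), 1 - g - \<pi> + m)]"
  have wf: "pmf_of_list_wf xs"
    using assms True by (intro pmf_of_list_wfI) (auto simp: xs_def m_def)
  have *: "measure (pmf_of_list xs) A = sum_list (map snd (filter (\<lambda>x. fst x \<in> A) xs))" for A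
    by (rule measure_pmf_of_list[OF wf])
  show thesis
    by (rule that[of "pmf_of_list xs"]; unfold contrast_def *)
       (use True assms in \<open>simp_all add: xs_def arm_defs m_def\<close>)
next
  case False
  \<comment> \<open>Mirror case: Y_11 is constantly false, Y_10 is true with probability
    \<open>- g\<close>, and \<open>m\<close> is its least overlap with the event that the surrogate
    is false, of probability \<open>1 - \<pi>\<close>.\<close>
  define m where "m = max 0 (- g - \<pi>)"
  define xs where "xs = [((True, False, False), m), ((True, False, True), - g - m),
    ((False, False, False), 1 - \<pi> - m), ((False, False, True), \<pi> + g + m)]"
  have wf: "pmf_of_list_wf xs"
    using assms False by (intro pmf_of_list_wfI) (auto simp: xs_def m_def)
  have *: "measure (pmf_of_list xs) A = sum_list (map snd (filter (\<lambda>x. fst x \<in> A) xs))" for A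
    by (rule measure_pmf_of_list[OF wf])
  show thesis
    by (rule that[of "pmf_of_list xs"]; unfold contrast_def *)
       (use False assms in \<open>simp_all add: xs_def arm_defs m_def\<close>)
qed

lemma response_upper_attained:
  fixes g \<pi> :: real
  assumes "\<bar>g\<bar> \<le> 1" "0 \<le> \<pi>" "\<pi> \<le> 1"
  obtains p :: "arm pmf" where "contrast p = g" "measure p {a. arm_surr a} = \<pi>"
    "measure p {a. arm_resp a} = Min {1, 1 - g + \<pi>, 1 + g + (1 - \<pi>)}"
proof -
  obtain p :: "arm pmf" where p: "contrast p = - g" "measure p {a. arm_surr a} = \<pi>"
    "measure p {a. arm_resp a} = Max {0, - (- g) - \<pi>, - g - (1 - \<pi>)}"
    using response_lower_attained[of "- g" \<pi>] assms by auto
  show thesis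
    by (rule that[of "map_pmf flip_prim p"];
        unfold surr_map_flip resp_map_flip contrast_map_flip p) auto
qed

text \<open>Arm 0 is kept, which preserves the table for T = 0 and \<gamma>_0. Arm 1 is observed
  only through its surrogate probability and contrast, so any law matching these two may replace
  it.\<close>

lemma same_observed_replace_arm:
  fixes D\<^sub>0 :: "('w, 'u) process" and p :: "arm pmf"
  assumes "randomized_process D\<^sub>0" "contrast p = contrast (arm_law D\<^sub>0 True)"
    "measure p {a. arm_surr a} = measure (arm_law D\<^sub>0 True) {a. arm_surr a}"
  obtains D :: "(bool \<times> bits6, bits6) process"
  where "randomized_process D" "same_observed D D\<^sub>0"
    "ACE D = measure p {a. arm_resp a} - measure (arm_law D\<^sub>0 False) {a. arm_resp a}"
proof -
  obtain D :: "(bool \<times> bits6, bits6) process" where D: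
    "randomized_process D" "arm_law D False = arm_law D\<^sub>0 False" "arm_law D True = p"
    by (rule randomized_process_with_arm_laws)
  have "measure p {a. arm_surr a = s} = measure (arm_law D\<^sub>0 True) {a. arm_surr a = s}" for s
    using assms(3) by (cases s) (simp_all add: measure_pmf_Collect_not)
  then have "same_observed D D\<^sub>0"
    using D assms by (simp add: same_observed_def prob_SY_arm prob_S_arm gam_arm)
  with D show thesis by (intro that[of D]) (simp_all add: ACE_arm)
qed

theorem theorem4:
  fixes D\<^sub>0 :: "('w, 'u) process"
  assumes "randomized_process D\<^sub>0"
  shows "(\<forall>D :: ('v, 'x) process.
            randomized_process D \<and> same_observed D D\<^sub>0 \<longrightarrow>
              lower_bound D\<^sub>0 \<le> ACE D \<and> ACE D \<le> upper_bound D\<^sub>0) \<and>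
         (\<exists>D :: (bool \<times> bits6, bits6) process.
            randomized_process D \<and> same_observed D D\<^sub>0 \<and> ACE D = lower_bound D\<^sub>0) \<and>
         (\<exists>D :: (bool \<times> bits6, bits6) process.
            randomized_process D \<and> same_observed D D\<^sub>0 \<and> ACE D = upper_bound D\<^sub>0)"
proof (intro conjI allI impI)
  fix D :: "('v, 'x) process"
  assume *: "randomized_process D \<and> same_observed D D\<^sub>0"
  \<comment> \<open>The bounds depend only on observed quantities, so those of \<open>D\<close>
    itself may be used; bounds and effect then subtract the same arm 0 response probability.\<close>
  then have b: "lower_bound D = lower_bound D\<^sub>0" "upper_bound D = upper_bound D\<^sub>0"
    using same_observed_bounds assms by blast+
  show "lower_bound D\<^sub>0 \<le> ACE D" "ACE D \<le> upper_bound D\<^sub>0"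
    unfolding b[symmetric] using * response_lower[of "arm_law D True"] response_upper[of "arm_law D True"]
    by (simp_all only: lower_bound_arm upper_bound_arm ACE_arm diff_right_mono)
next
  \<comment> \<open>For sharpness, arm 1 of \<open>D\<^sub>0\<close> is replaced by a law with the
    same contrast and surrogate probability but extreme response probability.\<close>
  let ?g = "contrast (arm_law D\<^sub>0 True)"
  let ?\<pi> = "measure (arm_law D\<^sub>0 True) {a. arm_surr a}"
  have r: "\<bar>?g\<bar> \<le> 1" "0 \<le> ?\<pi>" "?\<pi> \<le> 1"
    by (simp_all add: abs_contrast_le_1)
  obtain p :: "arm pmf" where p: "contrast p = ?g" "measure p {a. arm_surr a} = ?\<pi>"
    "measure p {a. arm_resp a} = Max {0, - ?g - ?\<pi>, ?g - (1 - ?\<pi>)}"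
    using response_lower_attained[OF r] by blast
  obtain D :: "(bool \<times> bits6, bits6) process" where
    "randomized_process D" "same_observed D D\<^sub>0"
    "ACE D = measure p {a. arm_resp a} - measure (arm_law D\<^sub>0 False) {a. arm_resp a}"
    by (rule same_observed_replace_arm[OF assms p(1,2)])
  then show "\<exists>D :: (bool \<times> bits6, bits6) process.
      randomized_process D \<and> same_observed D D\<^sub>0 \<and> ACE D = lower_bound D\<^sub>0"
    unfolding lower_bound_arm[OF assms] p(3) by blast
  obtain q :: "arm pmf" where q: "contrast q = ?g" "measure q {a. arm_surr a} = ?\<pi>"
    "measure q {a. arm_resp a} = Min {1, 1 - ?g + ?\<pi>, 1 + ?g + (1 - ?\<pi>)}"
    using response_upper_attained[OF r] by blast
  obtain D :: "(bool \<times> bits6, bits6) process" where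
    "randomized_process D" "same_observed D D\<^sub>0"
    "ACE D = measure q {a. arm_resp a} - measure (arm_law D\<^sub>0 False) {a. arm_resp a}"
    by (rule same_observed_replace_arm[OF assms q(1,2)])
  then show "\<exists>D :: (bool \<times> bits6, bits6) process.
      randomized_process D \<and> same_observed D D\<^sub>0 \<and> ACE D = upper_bound D\<^sub>0"
    unfolding upper_bound_arm[OF assms] q(3) by blast
qed

end
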